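(* Let $\mathcal K$ be a Cartesian category with binary coproducts and coequalizers, and let $F=(E,d,s):A\nrightarrow B$ be a loose morphism of $\mathbf{Mly}(\mathcal K)$. Then $F$ has a cotabulator in $\mathbf{Mly}(\mathcal K)$, whose object is the coequalizer $q:A+B\to Q$ in $\mathcal K$ of the two parallel morphisms $$\mathrm{inj}_B\circ s,\ \ \mathrm{inj}_A\circ\pi_A\ :\ A\times E\rightrightarrows A+B,$$ where $\pi_A:A\times E\to A$ is the projection and $\mathrm{inj}_A,\mathrm{inj}_B$ are the coproduct injections.
   Context: For $\mathcal K$ a category with finite products, $\mathbf{Mly}(\mathcal K)$ is the following pseudo double category. Objects and tight morphisms are those of $\mathcal K$. A loose morphism $A\nrightarrow B$ is a triple $(E,d,s)$ with $E$ an object (the carrier) and $d:A\times E\to E$, $s:A\times E\to B$ morphisms of $\mathcal K$. A cell from $(E,d,s):A\nrightarrow B$ to $(E',d',s'):X\nrightarrow Y$ with left side $f:A\to X$ and right side $g:B\to Y$ is a morphism $\alpha:E\to E'$ with $\alpha\circ d=d'\circ(f\times\alpha)$ and $g\circ s=s'\circ(f\times\alpha)$. The loose identity $\iota_A:A\nrightarrow A$ has carrier the terminal object $1$ and output map the projection $A\times 1\to A$. Vertical composition of cells is composition in $\mathcal K$. Every tight $f:A\to B$ induces the identity cell $\iota_f:\iota_A\Rightarrow\iota_B$, given by $\mathrm{id}_1$, with both sides $f$. A cotabulator of a loose morphism $F:A\nrightarrow B$ is an object $Q$ with a cell $\tau:F\Rightarrow\iota_Q$ (with left side some $a:A\to Q$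 and right side some $b:B\to Q$) such that every cell $\xi:F\Rightarrow\iota_X$ with left side $p:A\to X$ and right side $r:B\to X$ factors uniquely through $\tau$: there is a unique tight morphism $h:Q\to X$ with $ha=p$, $hb=r$ and $\iota_h\circ\tau=\xi$. *)

theory Defs
  imports Main
begin

section \<open>Categories\<close>

record ('o, 'm) cat =
  Obj :: "'o set"
  Arr :: "'m set"
  Dom :: "'m \<Rightarrow> 'o"
  Cod :: "'m \<Rightarrow> 'o"
  Ide :: "'o \<Rightarrow> 'm"
  Cmp :: "'m \<Rightarrow> 'm \<Rightarrow> 'm"  (infixr "\<cdot>\<index>" 70)

definition hom :: "('o, 'm, 'z) cat_scheme \<Rightarrow> 'o \<Rightarrow> 'o \<Rightarrow> 'm set" where
  "hom K A B = {f \<in> Arr K. Dom K f = A \<and> Cod K f = B}"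

locale category =
  fixes K :: "('o, 'm, 'z) cat_scheme" (structure)
  assumes Dom_Obj: "f \<in> Arr K \<Longrightarrow> Dom K f \<in> Obj K"
    and Cod_Obj: "f \<in> Arr K \<Longrightarrow> Cod K f \<in> Obj K"
    and Ide_hom: "A \<in> Obj K \<Longrightarrow> Ide K A \<in> hom K A A"
    and Cmp_hom: "f \<in> hom K A B \<Longrightarrow> g \<in> hom K B C \<Longrightarrow> g \<cdot> f \<in> hom K A C"
    and Cmp_Ide: "f \<in> hom K A B \<Longrightarrow> f \<cdot> Ide K A = f"
    and Ide_Cmp: "f \<in> hom K A B \<Longrightarrow> Ide K B \<cdot> f = f"
    and Cmp_assoc: "f \<in> hom K A B \<Longrightarrow> g \<in> hom K B C \<Longrightarrow> h \<in> hom K C D \<Longrightarrow>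
          (h \<cdot> g) \<cdot> f = h \<cdot> (g \<cdot> f)"

definition is_terminal :: "('o, 'm, 'z) cat_scheme \<Rightarrow> 'o \<Rightarrow> bool" where
  "is_terminal K T \<longleftrightarrow> T \<in> Obj K \<and> (\<forall>X\<in>Obj K. \<exists>!f. f \<in> hom K X T)"

definition is_product ::
    "('o, 'm, 'z) cat_scheme \<Rightarrow> 'o \<Rightarrow> 'o \<Rightarrow> 'o \<Rightarrow> 'm \<Rightarrow> 'm \<Rightarrow> bool" where
  "is_product K A B P p1 p2 \<longleftrightarrow>
     P \<in> Obj K \<and> p1 \<in> hom K P A \<and> p2 \<in> hom K P B \<and>
     (\<forall>X\<in>Obj K. \<forall>f\<in>hom K X A. \<forall>g\<in>hom K X B.
        \<exists>!u. u \<in> hom K X P \<and> p1 \<cdot>\<^bsub>K\<^esub> u = f \<and> p2 \<cdot>\<^bsub>K\<^esub> u = g)"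

definition is_coproduct ::
    "('o, 'm, 'z) cat_scheme \<Rightarrow> 'o \<Rightarrow> 'o \<Rightarrow> 'o \<Rightarrow> 'm \<Rightarrow> 'm \<Rightarrow> bool" where
  "is_coproduct K A B S i1 i2 \<longleftrightarrow>
     S \<in> Obj K \<and> i1 \<in> hom K A S \<and> i2 \<in> hom K B S \<and>
     (\<forall>X\<in>Obj K. \<forall>f\<in>hom K A X. \<forall>g\<in>hom K B X.
        \<exists>!u. u \<in> hom K S X \<and> u \<cdot>\<^bsub>K\<^esub> i1 = f \<and> u \<cdot>\<^bsub>K\<^esub> i2 = g)"

definition is_coequalizer ::
    "('o, 'm, 'z) cat_scheme \<Rightarrow> 'o \<Rightarrow> 'o \<Rightarrow> 'm \<Rightarrow> 'm \<Rightarrow> 'o \<Rightarrow> 'm \<Rightarrow> bool" where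
  "is_coequalizer K U V f g Q q \<longleftrightarrow>
     f \<in> hom K U V \<and> g \<in> hom K U V \<and>
     Q \<in> Obj K \<and> q \<in> hom K V Q \<and> q \<cdot>\<^bsub>K\<^esub> f = q \<cdot>\<^bsub>K\<^esub> g \<and>
     (\<forall>X\<in>Obj K. \<forall>k\<in>hom K V X. k \<cdot>\<^bsub>K\<^esub> f = k \<cdot>\<^bsub>K\<^esub> g \<longrightarrow>
        (\<exists>!u. u \<in> hom K Q X \<and> u \<cdot>\<^bsub>K\<^esub> q = k))"

definition has_binary_coproducts :: "('o, 'm, 'z) cat_scheme \<Rightarrow> bool" where
  "has_binary_coproducts K \<longleftrightarrow>
     (\<forall>A\<in>Obj K. \<forall>B\<in>Obj K. \<exists>S i1 i2. is_coproduct K A B S i1 i2)"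

definition has_coequalizers :: "('o, 'm, 'z) cat_scheme \<Rightarrow> bool" where
  "has_coequalizers K \<longleftrightarrow>
     (\<forall>U\<in>Obj K. \<forall>V\<in>Obj K. \<forall>f\<in>hom K U V. \<forall>g\<in>hom K U V. \<exists>Q q. is_coequalizer K U V f g Q q)"


section \<open>Cartesian categories\<close>

text \<open>
  Mealy machines refer to \<open>A \<times> E\<close> and \<open>1\<close> as objects, so a cartesian category comes with an
  arbitrary choice of binary products and of a terminal object.
\<close>

record ('o, 'm) cartesian_cat = "('o, 'm) cat" +
  One :: 'o
  Prod :: "'o \<Rightarrow> 'o \<Rightarrow> 'o"
  Fst :: "'o \<Rightarrow> 'o \<Rightarrow> 'm"
  Snd :: "'o \<Rightarrow> 'o \<Rightarrow> 'm"

locale cartesian_category = category K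
  for K :: "('o, 'm, 'z) cartesian_cat_scheme" (structure) +
  assumes One_terminal: "is_terminal K (One K)"
    and Prod_product: "A \<in> Obj K \<Longrightarrow> B \<in> Obj K \<Longrightarrow>
          is_product K A B (Prod K A B) (Fst K A B) (Snd K A B)"

definition prod_map :: "('o, 'm, 'z) cartesian_cat_scheme \<Rightarrow> 'm \<Rightarrow> 'm \<Rightarrow> 'm" where
  "prod_map K f g =
     (THE u. u \<in> hom K (Prod K (Dom K f) (Dom K g)) (Prod K (Cod K f) (Cod K g)) \<and>
        Fst K (Cod K f) (Cod K g) \<cdot>\<^bsub>K\<^esub> u = f \<cdot>\<^bsub>K\<^esub> Fst K (Dom K f) (Dom K g) \<and>
        Snd K (Cod K f) (Cod K g) \<cdot>\<^bsub>K\<^esub> u = g \<cdot>\<^bsub>K\<^esub> Snd K (Dom K f) (Dom K g))"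


section \<open>The double category of Mealy machines\<close>

text \<open>
  Objects and tight morphisms are those of \<open>K\<close>. Composition of loose morphisms plays no role for
  cotabulators and is not introduced.
\<close>

type_synonym ('o, 'm) mealy = "'o \<times> 'm \<times> 'm"

definition mly_loose ::
    "('o, 'm, 'z) cartesian_cat_scheme \<Rightarrow> 'o \<Rightarrow> 'o \<Rightarrow> ('o, 'm) mealy set" where
  "mly_loose K A B = {(E, d, s). A \<in> Obj K \<and> B \<in> Obj K \<and> E \<in> Obj K \<and>
     d \<in> hom K (Prod K A E) E \<and> s \<in> hom K (Prod K A E) B}"

text \<open>
  \<open>mly_cells K A B F X Y F' f g\<close> is the set of cells from \<open>F : A \<rightarrow> B\<close> to \<open>F' : X \<rightarrow> Y\<close> with left
  side \<open>f\<close> and right side \<open>g\<close>.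
\<close>

definition mly_cells ::
    "('o, 'm, 'z) cartesian_cat_scheme \<Rightarrow> 'o \<Rightarrow> 'o \<Rightarrow> ('o, 'm) mealy \<Rightarrow> 'o \<Rightarrow> 'o \<Rightarrow> ('o, 'm) mealy
      \<Rightarrow> 'm \<Rightarrow> 'm \<Rightarrow> 'm set" where
  "mly_cells K A B F X Y F' f g = {\<alpha>.
     F \<in> mly_loose K A B \<and> F' \<in> mly_loose K X Y \<and> f \<in> hom K A X \<and> g \<in> hom K B Y \<and>
     (case F of (E, d, s) \<Rightarrow> case F' of (E', d', s') \<Rightarrow>
        \<alpha> \<in> hom K E E' \<and>
        \<alpha> \<cdot>\<^bsub>K\<^esub> d = d' \<cdot>\<^bsub>K\<^esub> prod_map K f \<alpha> \<and>
        g \<cdot>\<^bsub>K\<^esub> s = s' \<cdot>\<^bsub>K\<^esub> prod_map K f \<alpha>)}"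

definition mly_vcomp :: "('o, 'm, 'z) cartesian_cat_scheme \<Rightarrow> 'm \<Rightarrow> 'm \<Rightarrow> 'm" where
  "mly_vcomp K \<beta> \<alpha> = \<beta> \<cdot>\<^bsub>K\<^esub> \<alpha>"

definition mly_unit :: "('o, 'm, 'z) cartesian_cat_scheme \<Rightarrow> 'o \<Rightarrow> ('o, 'm) mealy" where
  "mly_unit K A = (One K, Snd K A (One K), Fst K A (One K))"

text \<open>The carrier map of \<open>\<iota>\<^sub>f\<close> does not depend on \<open>f\<close>; only the sides of the cell do.\<close>

definition mly_unit_cell :: "('o, 'm, 'z) cartesian_cat_scheme \<Rightarrow> 'm \<Rightarrow> 'm" where
  "mly_unit_cell K f = Ide K (One K)"

definition is_cotabulator ::
    "('o, 'm, 'z) cartesian_cat_scheme \<Rightarrow> 'o \<Rightarrow> 'o \<Rightarrow> ('o, 'm) mealy \<Rightarrow> 'o \<Rightarrow> 'm \<Rightarrow> 'm \<Rightarrow> 'm \<Rightarrow> bool"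
  where
  "is_cotabulator K A B F Q a b \<tau> \<longleftrightarrow>
     Q \<in> Obj K \<and> \<tau> \<in> mly_cells K A B F Q Q (mly_unit K Q) a b \<and>
     (\<forall>X\<in>Obj K. \<forall>p\<in>hom K A X. \<forall>r\<in>hom K B X.
        \<forall>\<xi>\<in>mly_cells K A B F X X (mly_unit K X) p r.
          \<exists>!h. h \<in> hom K Q X \<and> h \<cdot>\<^bsub>K\<^esub> a = p \<and> h \<cdot>\<^bsub>K\<^esub> b = r \<and>
             mly_vcomp K (mly_unit_cell K h) \<tau> = \<xi>)"


section \<open>Well-formedness of the cells involved\<close>

context cartesian_category
begin

lemma hom_Obj: "f \<in> hom K A B \<Longrightarrow> A \<in> Obj K \<and> B \<in> Obj K"
  using Dom_Obj Cod_Obj by (auto simp: hom_def)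

lemma prod_map:
  assumes f: "f \<in> hom K A X" and g: "g \<in> hom K B Y"
  shows "prod_map K f g \<in> hom K (Prod K A B) (Prod K X Y) \<and>
    Fst K X Y \<cdot> prod_map K f g = f \<cdot> Fst K A B \<and> Snd K X Y \<cdot> prod_map K f g = g \<cdot> Snd K A B"
proof -
  have o: "A \<in> Obj K" "B \<in> Obj K" "X \<in> Obj K" "Y \<in> Obj K"
    using assms hom_Obj by auto
  have e: "Dom K f = A" "Cod K f = X" "Dom K g = B" "Cod K g = Y"
    using assms by (auto simp: hom_def)
  have P: "is_product K A B (Prod K A B) (Fst K A B) (Snd K A B)"
    and R: "is_product K X Y (Prod K X Y) (Fst K X Y) (Snd K X Y)"
    using o Prod_product by auto
  have "f \<cdot> Fst K A B \<in> hom K (Prod K A B) X" "g \<cdot> Snd K A B \<in> hom K (Prod K A B) Y"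
    using P f g Cmp_hom unfolding is_product_def by blast+
  then have "\<exists>!u. u \<in> hom K (Prod K A B) (Prod K X Y) \<and>
      Fst K X Y \<cdot> u = f \<cdot> Fst K A B \<and> Snd K X Y \<cdot> u = g \<cdot> Snd K A B"
    using P R unfolding is_product_def by blast
  from theI'[OF this] show ?thesis unfolding prod_map_def e .
qed

lemma One_Obj: "One K \<in> Obj K"
  using One_terminal by (simp add: is_terminal_def)

lemma mly_unit_loose: "A \<in> Obj K \<Longrightarrow> mly_unit K A \<in> mly_loose K A A"
  using Prod_product[of A "One K"] One_Obj
  by (auto simp: mly_unit_def mly_loose_def is_product_def)

lemma mly_unit_cell:
  assumes f: "f \<in> hom K A B"
  shows "mly_unit_cell K f \<in> mly_cells K A A (mly_unit K A) B B (mly_unit K B) f f"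
proof -
  have o: "A \<in> Obj K" "B \<in> Obj K" using f hom_Obj by auto
  have i: "Ide K (One K) \<in> hom K (One K) (One K)" using One_Obj Ide_hom by blast
  show ?thesis
    using o f i prod_map[OF f i] mly_unit_loose
    unfolding mly_cells_def mly_unit_cell_def by (auto simp: mly_unit_def)
qed

end

end

(* A cell from (E, d, s) into a loose identity has a uniquely determined carrier map, into the
   terminal object, so it amounts to a pair of tight morphisms p, r with r s = p pi_A. Such pairs
   are the same as cocones [p, r] under the two parallel morphisms into A + B. *)
theory Submission
  imports Defs
begin

context cartesian_category
begin

lemma hom_One_unique: "f \<in> hom K X (One K) \<Longrightarrow> g \<in> hom K X (One K) \<Longrightarrow> f = g"
  using One_terminal hom_Obj[of f] unfolding is_terminal_def by blast

text \<open>The transition equation compares two maps into the terminal object, hence holds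
  automatically. The output map of \<open>mly_unit K X\<close> is a first projection, so composing
  it with \<open>prod_map K p \<alpha>\<close> gives \<open>p \<cdot> Fst K A E\<close>, which no
  longer mentions \<open>\<alpha>\<close>.\<close>

lemma mly_cells_unit_iff:
  assumes F: "(E, d, s) \<in> mly_loose K A B" and p: "p \<in> hom K A X" and r: "r \<in> hom K B X"
  shows "\<alpha> \<in> mly_cells K A B (E, d, s) X X (mly_unit K X) p r \<longleftrightarrow>
    \<alpha> \<in> hom K E (One K) \<and> r \<cdot> s = p \<cdot> Fst K A E"
proof -
  have X: "X \<in> Obj K" using p hom_Obj by blast
  have d: "d \<in> hom K (Prod K A E) E" using F by (simp add: mly_loose_def)
  have Snd: "Snd K X (One K) \<in> hom K (Prod K X (One K)) (One K)"
    using Prod_product[OF X One_Obj] by (simp add: is_product_def)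
  have transition: "\<alpha> \<cdot> d = Snd K X (One K) \<cdot> prod_map K p \<alpha>"
    and out: "Fst K X (One K) \<cdot> prod_map K p \<alpha> = p \<cdot> Fst K A E"
    if \<alpha>: "\<alpha> \<in> hom K E (One K)"
    using hom_One_unique[OF Cmp_hom[OF d \<alpha>]] Cmp_hom[OF _ Snd] prod_map[OF p \<alpha>] by blast+
  show ?thesis
    using transition out F p r mly_unit_loose[OF X]
    by (auto simp: mly_cells_def mly_unit_def)
qed

text \<open>Carrier maps into \<open>One K\<close> always agree, so factoring a cell through
  \<open>\<tau>\<close> only concerns its sides \<open>p\<close> and \<open>r\<close>: first copair
  them by the coproduct, then descend along \<open>q\<close>.\<close>

lemma is_cotabulator_coequalizer:
  assumes F: "(E, d, s) \<in> mly_loose K A B"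
    and S: "is_coproduct K A B S injA injB"
    and Q: "is_coequalizer K (Prod K A E) S (injB \<cdot> s) (injA \<cdot> Fst K A E) Q q"
    and \<tau>: "\<tau> \<in> hom K E (One K)"
  shows "is_cotabulator K A B (E, d, s) Q (q \<cdot> injA) (q \<cdot> injB) \<tau>"
proof -
  have obj: "A \<in> Obj K" "E \<in> Obj K" and s: "s \<in> hom K (Prod K A E) B"
    using F by (auto simp: mly_loose_def)
  have Fst: "Fst K A E \<in> hom K (Prod K A E) A"
    using Prod_product[OF obj] by (simp add: is_product_def)
  have injA: "injA \<in> hom K A S" and injB: "injB \<in> hom K B S"
    using S by (auto simp: is_coproduct_def)
  have q: "q \<in> hom K S Q" and QObj: "Q \<in> Obj K"
    and coeq: "q \<cdot> injB \<cdot> s = q \<cdot> injA \<cdot> Fst K A E"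
    using Q by (auto simp: is_coequalizer_def)
  have a: "q \<cdot> injA \<in> hom K A Q" and b: "q \<cdot> injB \<in> hom K B Q"
    using Cmp_hom injA injB q by blast+
  \<comment> \<open>Composition associates to the right, whereas the output condition of a cell has
    the bracketing on the left. The general \<open>k\<close> covers both \<open>q\<close> and the
    copairing of \<open>p\<close> and \<open>r\<close>.\<close>
  have assoc: "(k \<cdot> injB) \<cdot> s = k \<cdot> injB \<cdot> s" "(k \<cdot> injA) \<cdot> Fst K A E = k \<cdot> injA \<cdot> Fst K A E"
    if "k \<in> hom K S X" for k X
    using Cmp_assoc s Fst injA injB that by blast+
  \<comment> \<open>For these two sides the output condition is exactly the coequalizer equation
    \<open>coeq\<close>.\<close>
  have cell: "\<tau> \<in> mly_cells K A B (E, d, s) Q Q (mly_unit K Q) (q \<cdot> injA) (q \<cdot> injB)"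
    using mly_cells_unit_iff[OF F a b] \<tau> coeq assoc[OF q] by simp
  have "\<exists>!h. h \<in> hom K Q X \<and> h \<cdot> q \<cdot> injA = p \<and> h \<cdot> q \<cdot> injB = r \<and>
      mly_vcomp K (mly_unit_cell K h) \<tau> = \<xi>"
    if X: "X \<in> Obj K" and p: "p \<in> hom K A X" and r: "r \<in> hom K B X"
      and \<xi>: "\<xi> \<in> mly_cells K A B (E, d, s) X X (mly_unit K X) p r" for X p r \<xi>
  proof -
    have \<xi>_hom: "\<xi> \<in> hom K E (One K)" and rs: "r \<cdot> s = p \<cdot> Fst K A E"
      using \<xi> mly_cells_unit_iff[OF F p r] by auto
    \<comment> \<open>The identity cell is carried by the identity of \<open>One K\<close>, so the
      composite is \<open>\<tau>\<close>, which equals \<open>\<xi>\<close> by terminality, whatever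
      \<open>h\<close> is.\<close>
    have vcomp: "mly_vcomp K (mly_unit_cell K h) \<tau> = \<xi>" for h
      using Ide_Cmp[OF \<tau>] hom_One_unique[OF \<tau> \<xi>_hom]
      by (simp add: mly_vcomp_def mly_unit_cell_def)
    have copair: "\<exists>!k. k \<in> hom K S X \<and> k \<cdot> injA = p \<and> k \<cdot> injB = r"
      using S X p r unfolding is_coproduct_def by blast
    then obtain k where k: "k \<in> hom K S X" "k \<cdot> injA = p" "k \<cdot> injB = r" by blast
    have "k \<cdot> injB \<cdot> s = k \<cdot> injA \<cdot> Fst K A E"
      using assoc[OF k(1)] k rs by simp
    then have fact: "\<exists>!h. h \<in> hom K Q X \<and> h \<cdot> q = k"
      using Q X k(1) unfolding is_coequalizer_def by blast
    \<comment> \<open>Uniqueness of the copairing turns the two side conditions into the single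
      equation whose unique solution is given by \<open>fact\<close>.\<close>
    have "h \<cdot> q \<cdot> injA = p \<and> h \<cdot> q \<cdot> injB = r \<longleftrightarrow> h \<cdot> q = k" if h: "h \<in> hom K Q X" for h
    proof -
      have "h \<cdot> q \<cdot> injA = (h \<cdot> q) \<cdot> injA" "h \<cdot> q \<cdot> injB = (h \<cdot> q) \<cdot> injB"
        using Cmp_assoc injA injB q h by metis+
      then show ?thesis using copair k Cmp_hom[OF q h] by auto
    qed
    then show ?thesis using fact vcomp by (smt (verit))
  qed
  then show ?thesis using QObj cell unfolding is_cotabulator_def by blast
qed

end

theorem mainTheorem9:
  fixes K :: "('o, 'm, 'z) cartesian_cat_scheme"
    and A B E :: 'o and d s :: 'm
  assumes "cartesian_category K"
    and "has_binary_coproducts K"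
    and "has_coequalizers K"
    and "(E, d, s) \<in> mly_loose K A B"
  shows "(\<exists>Q a b \<tau>. is_cotabulator K A B (E, d, s) Q a b \<tau>) \<and>
    (\<forall>S injA injB Q q.
       is_coproduct K A B S injA injB \<longrightarrow>
       is_coequalizer K (Prod K A E) S (injB \<cdot>\<^bsub>K\<^esub> s) (injA \<cdot>\<^bsub>K\<^esub> Fst K A E) Q q \<longrightarrow>
       (\<exists>\<tau>. is_cotabulator K A B (E, d, s) Q (q \<cdot>\<^bsub>K\<^esub> injA) (q \<cdot>\<^bsub>K\<^esub> injB) \<tau>))"
proof -
  interpret cartesian_category K by fact
  have obj: "A \<in> Obj K" "B \<in> Obj K" "E \<in> Obj K" and s: "s \<in> hom K (Prod K A E) B"
    using assms(4) by (auto simp: mly_loose_def)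
  obtain \<tau> where \<tau>: "\<tau> \<in> hom K E (One K)"
    using One_terminal obj(3) unfolding is_terminal_def by blast
  obtain S injA injB where S: "is_coproduct K A B S injA injB"
    using assms(2) obj unfolding has_binary_coproducts_def by blast
  have prod: "Prod K A E \<in> Obj K" "Fst K A E \<in> hom K (Prod K A E) A"
    using Prod_product[OF obj(1,3)] by (auto simp: is_product_def)
  have "S \<in> Obj K" "injB \<cdot>\<^bsub>K\<^esub> s \<in> hom K (Prod K A E) S"
    "injA \<cdot>\<^bsub>K\<^esub> Fst K A E \<in> hom K (Prod K A E) S"
    using S s prod(2) Cmp_hom unfolding is_coproduct_def by blast+
  then obtain Q q where
    "is_coequalizer K (Prod K A E) S (injB \<cdot>\<^bsub>K\<^esub> s) (injA \<cdot>\<^bsub>K\<^esub> Fst K A E) Q q"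
    using assms(3) prod(1) unfolding has_coequalizers_def by blast
  \<comment> \<open>The lemma applies to every coproduct and coequalizer, giving the second
    conjunct; the pair just obtained yields existence.\<close>
  then show ?thesis
    using is_cotabulator_coequalizer[OF assms(4) _ _ \<tau>] S by blast
qed

end
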